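(* Let $X$ be a set, $E$ a nonempty set of parameters, $N\ge 1$ an integer, let $(X,\mathcal{T}_i,N,E)$ be an $N$-wise soft $T_1$-space (respectively an $N$-wise soft $T_2$-space) over $X$, and let $Y$ be a nonempty subset of $X$. Then the soft $N$-topological subspace $(Y,\mathcal{T}_{i,Y},N,E)$ on $Y$ is an $N$-wise soft $T_1$-space (respectively an $N$-wise soft $T_2$-space).
   Context: A soft set over a set $Z$ (with respect to the fixed nonempty parameter set $E$) is a pair $(F,E)$ where $F:E\to\mathcal{P}(Z)$ is any map. The null soft set has $F(e)=\emptyset$ for all $e$; the absolute soft set over $Z$ has $F(e)=Z$ for all $e$. Soft unions and soft intersections are defined parameterwise: the soft union of $\{(F_i,E)\}_{i\in I}$ is given by $e\mapsto\bigcup_i F_i(e)$ and the soft intersection of $(F,E)$ and $(G,E)$ by $e\mapsto F(e)\cap G(e)$. A soft topology on $Z$ with respect to $E$ is a family $\mathcal{T}$ of soft sets over $Z$ that contains the null and the absolute soft sets, and is closed under soft intersections of two members and under arbitrary soft unions. A soft $N$-topological space $(Z,\mathcal{T}_i,N,E)$ over $Z$ is the set $Z$ equipped with $N$ different soft topologies $\mathcal{T}_1,\dots,\mathcal{T}_N$ on $Z$ with respect to the same $E$. A soft set over $Z$ is a soft $N$-open set if it belongs to $\mathcal{T}_j$ for some $j\in\{1,\dots,N\}$. For a nonempty $Y\subseteq X$, the soft relative topology on $Y$ of a soft topology $\mathcal{T}$ on $X$ is $\mathcal{T}_Y=\{({}^{Y}F,E) : (F,E)\in\mathcal{T}\}$,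 where ${}^{Y}F(e)=F(e)\cap Y$ for all $e\in E$. The soft $N$-topological subspace of $(X,\mathcal{T}_i,N,E)$ on $Y$ is the soft $N$-topological space $(Y,\mathcal{T}_{i,Y},N,E)$, i.e. $Y$ equipped with the soft relative topologies $\mathcal{T}_{1,Y},\dots,\mathcal{T}_{N,Y}$ of $\mathcal{T}_1,\dots,\mathcal{T}_N$ on $Y$. For $x\in Z$ and $\alpha\in E$, the soft point $(x_\alpha,E)$ over $Z$ is the soft set with value $\{x\}$ at $\alpha$ and $\emptyset$ at every other parameter. It soft belongs to $(F,E)$ iff $x\in F(\alpha)$. Soft points $(x_\alpha,E)$ and $(y_\beta,E)$ are distinct iff $x\ne y$ or $\alpha\ne\beta$. A soft $N$-topological space over $Z$ is: - an $N$-wise soft $T_1$-space if for every pair of distinct soft points $(x_\alpha,E),(y_\beta,E)$ over $Z$ (taken in either order) there exists a soft $N$-open set $(A,E)$ such that $(x_\alpha,E)$ soft belongs to $(A,E)$ and $(y_\beta,E)$ does not; - an $N$-wise soft $T_2$-space if for every pair of distinct soft points $(x_\alpha,E),(y_\beta,E)$ over $Z$ there exist two soft $N$-open sets $(A,E),(B,E)$ such that $(x_\alpha,E)$ soft belongs to $(A,E)$, $(y_\beta,E)$ soft belongs to $(B,E)$, and the soft intersection of $(A,E)$ and $(B,E)$ is the null soft set. *)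

theory Defs
  imports "HOL-Library.FuncSet"
begin

text \<open>
  A soft set over Z is a map from the parameter set E to the subsets of Z. It is represented by
  an extensional function, so that HOL equality of soft sets is equality on E.
\<close>

type_synonym ('e, 'a) soft_set = "'e \<Rightarrow> 'a set"

definition soft_sets :: "'e set \<Rightarrow> 'a set \<Rightarrow> ('e, 'a) soft_set set" where
  "soft_sets E Z = (E \<rightarrow>\<^sub>E Pow Z)"

definition null_soft_set :: "'e set \<Rightarrow> ('e, 'a) soft_set" where
  "null_soft_set E = (\<lambda>e\<in>E. {})"

definition absolute_soft_set :: "'e set \<Rightarrow> 'a set \<Rightarrow> ('e, 'a) soft_set" where
  "absolute_soft_set E Z = (\<lambda>e\<in>E. Z)"

definition soft_Union :: "'e set \<Rightarrow> ('e, 'a) soft_set set \<Rightarrow> ('e, 'a) soft_set" where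
  "soft_Union E \<F> = (\<lambda>e\<in>E. \<Union>F\<in>\<F>. F e)"

definition soft_inter ::
    "'e set \<Rightarrow> ('e, 'a) soft_set \<Rightarrow> ('e, 'a) soft_set \<Rightarrow> ('e, 'a) soft_set" where
  "soft_inter E F G = (\<lambda>e\<in>E. F e \<inter> G e)"

definition soft_topology :: "'e set \<Rightarrow> 'a set \<Rightarrow> ('e, 'a) soft_set set \<Rightarrow> bool" where
  "soft_topology E Z \<T> \<longleftrightarrow>
     \<T> \<subseteq> soft_sets E Z \<and>
     null_soft_set E \<in> \<T> \<and>
     absolute_soft_set E Z \<in> \<T> \<and>
     (\<forall>F\<in>\<T>. \<forall>G\<in>\<T>. soft_inter E F G \<in> \<T>) \<and>
     (\<forall>\<F>. \<F> \<subseteq> \<T> \<longrightarrow> soft_Union E \<F> \<in> \<T>)"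

text \<open>
  A soft N-topological space is a family of soft topologies indexed by 1, ..., N; values of the
  family at other indices are irrelevant. Members of the family are allowed to coincide: even when
  the soft topologies on X are pairwise distinct, their relative topologies on Y need not be, so
  a distinctness requirement would not be inherited by subspaces.
\<close>

definition soft_N_topological_space ::
    "'a set \<Rightarrow> (nat \<Rightarrow> ('e, 'a) soft_set set) \<Rightarrow> nat \<Rightarrow> 'e set \<Rightarrow> bool" where
  "soft_N_topological_space Z \<T> N E \<longleftrightarrow> (\<forall>i\<in>{1..N}. soft_topology E Z (\<T> i))"

definition soft_N_open ::
    "(nat \<Rightarrow> ('e, 'a) soft_set set) \<Rightarrow> nat \<Rightarrow> ('e, 'a) soft_set \<Rightarrow> bool" where
  "soft_N_open \<T> N A \<longleftrightarrow> (\<exists>j\<in>{1..N}. A \<in> \<T> j)"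

definition soft_trace :: "'e set \<Rightarrow> 'a set \<Rightarrow> ('e, 'a) soft_set \<Rightarrow> ('e, 'a) soft_set" where
  "soft_trace E Y F = (\<lambda>e\<in>E. F e \<inter> Y)"

definition soft_relative_topology ::
    "'e set \<Rightarrow> 'a set \<Rightarrow> ('e, 'a) soft_set set \<Rightarrow> ('e, 'a) soft_set set" where
  "soft_relative_topology E Y \<T> = {soft_trace E Y F | F. F \<in> \<T>}"

definition soft_N_subspace ::
    "'e set \<Rightarrow> 'a set \<Rightarrow> (nat \<Rightarrow> ('e, 'a) soft_set set) \<Rightarrow> nat \<Rightarrow> ('e, 'a) soft_set set" where
  "soft_N_subspace E Y \<T> = (\<lambda>i. soft_relative_topology E Y (\<T> i))"

definition soft_point :: "'e set \<Rightarrow> 'a \<Rightarrow> 'e \<Rightarrow> ('e, 'a) soft_set" where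
  "soft_point E x \<alpha> = (\<lambda>e\<in>E. if e = \<alpha> then {x} else {})"

definition soft_belongs :: "'e set \<Rightarrow> ('e, 'a) soft_set \<Rightarrow> ('e, 'a) soft_set \<Rightarrow> bool" where
  "soft_belongs E P F \<longleftrightarrow> (\<exists>x. \<exists>\<alpha>\<in>E. P = soft_point E x \<alpha> \<and> x \<in> F \<alpha>)"

lemma soft_point_eq_iff:
  assumes "\<alpha> \<in> E" "\<beta> \<in> E"
  shows "soft_point E x \<alpha> = soft_point E y \<beta> \<longleftrightarrow> x = y \<and> \<alpha> = \<beta>"
proof
  assume "soft_point E x \<alpha> = soft_point E y \<beta>"
  then have "soft_point E x \<alpha> \<alpha> = soft_point E y \<beta> \<alpha>" by simp
  then show "x = y \<and> \<alpha> = \<beta>" using assms by (auto simp: soft_point_def split: if_splits)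
qed simp

lemma soft_belongs_soft_point:
  assumes "\<alpha> \<in> E"
  shows "soft_belongs E (soft_point E x \<alpha>) F \<longleftrightarrow> x \<in> F \<alpha>"
  using assms by (auto simp: soft_belongs_def soft_point_eq_iff)

definition N_wise_soft_T1 ::
    "'a set \<Rightarrow> (nat \<Rightarrow> ('e, 'a) soft_set set) \<Rightarrow> nat \<Rightarrow> 'e set \<Rightarrow> bool" where
  "N_wise_soft_T1 Z \<T> N E \<longleftrightarrow>
     soft_N_topological_space Z \<T> N E \<and>
     (\<forall>x\<in>Z. \<forall>\<alpha>\<in>E. \<forall>y\<in>Z. \<forall>\<beta>\<in>E. x \<noteq> y \<or> \<alpha> \<noteq> \<beta> \<longrightarrow>
        (\<exists>A. soft_N_open \<T> N A \<and>
             soft_belongs E (soft_point E x \<alpha>) A \<and> \<not> soft_belongs E (soft_point E y \<beta>) A))"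

definition N_wise_soft_T2 ::
    "'a set \<Rightarrow> (nat \<Rightarrow> ('e, 'a) soft_set set) \<Rightarrow> nat \<Rightarrow> 'e set \<Rightarrow> bool" where
  "N_wise_soft_T2 Z \<T> N E \<longleftrightarrow>
     soft_N_topological_space Z \<T> N E \<and>
     (\<forall>x\<in>Z. \<forall>\<alpha>\<in>E. \<forall>y\<in>Z. \<forall>\<beta>\<in>E. x \<noteq> y \<or> \<alpha> \<noteq> \<beta> \<longrightarrow>
        (\<exists>A B. soft_N_open \<T> N A \<and> soft_N_open \<T> N B \<and>
               soft_belongs E (soft_point E x \<alpha>) A \<and> soft_belongs E (soft_point E y \<beta>) B \<and>
               soft_inter E A B = null_soft_set E))"

end

theory Submission
  imports Defs
begin

text \<open>
  Both separation axioms pass to \<open>Y\<close> because tracing on \<open>Y\<close> does not change which points of \<open>Y\<close>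
  lie in a soft set: distinct soft points over \<open>Y\<close> are distinct soft points over \<open>X\<close>, and the
  traces of the soft N-open sets that separate them over \<open>X\<close> separate them over \<open>Y\<close>
  (\<open>soft_belongs_soft_trace\<close>). Disjointness survives as well, since tracing commutes with soft
  intersections and preserves the null soft set.

  The subspace is a soft N-topological space for the same reason: tracing commutes with all the
  operations under which a soft topology is closed (\<open>soft_topology_relative\<close>).
\<close>

lemma soft_trace_null: "soft_trace E Y (null_soft_set E) = null_soft_set E"
  by (auto simp: soft_trace_def null_soft_set_def fun_eq_iff)

lemma soft_trace_absolute:
  "Y \<subseteq> X \<Longrightarrow> soft_trace E Y (absolute_soft_set E X) = absolute_soft_set E Y"
  by (auto simp: soft_trace_def absolute_soft_set_def fun_eq_iff)

lemma soft_trace_inter: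
  "soft_trace E Y (soft_inter E F G) = soft_inter E (soft_trace E Y F) (soft_trace E Y G)"
  by (auto simp: soft_trace_def soft_inter_def fun_eq_iff)

lemma soft_trace_Union:
  "soft_trace E Y (soft_Union E \<F>) = soft_Union E (soft_trace E Y ` \<F>)"
  by (auto simp: soft_trace_def soft_Union_def fun_eq_iff)

lemma soft_trace_in_soft_sets: "soft_trace E Y F \<in> soft_sets E Y"
  by (auto simp: soft_trace_def soft_sets_def)

lemma soft_relative_topology_eq_image: "soft_relative_topology E Y \<T> = soft_trace E Y ` \<T>"
  by (auto simp: soft_relative_topology_def)

text \<open>
  An arbitrary family of relatively open soft sets is the image under tracing of a family of open
  soft sets, so its soft union is the trace of an open soft set.
\<close>

lemma soft_topology_relative:
  assumes "soft_topology E X \<T>" and "Y \<subseteq> X"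
  shows "soft_topology E Y (soft_relative_topology E Y \<T>)"
  unfolding soft_topology_def soft_relative_topology_eq_image
proof (intro conjI ballI allI impI)
  show "soft_trace E Y ` \<T> \<subseteq> soft_sets E Y"
    by (auto simp: soft_trace_in_soft_sets)
  show "null_soft_set E \<in> soft_trace E Y ` \<T>"
    using assms(1) soft_trace_null unfolding soft_topology_def by (metis imageI)
  show "absolute_soft_set E Y \<in> soft_trace E Y ` \<T>"
    using assms(1) soft_trace_absolute[OF assms(2)] unfolding soft_topology_def by (metis imageI)
  show "soft_inter E F G \<in> soft_trace E Y ` \<T>"
    if "F \<in> soft_trace E Y ` \<T>" "G \<in> soft_trace E Y ` \<T>" for F G
    using that assms(1) unfolding soft_topology_def
    by (auto simp: soft_trace_inter[symmetric])
  show "soft_Union E \<F> \<in> soft_trace E Y ` \<T>" if family: "\<F> \<subseteq> soft_trace E Y ` \<T>" for \<F>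
  proof -
    obtain \<G> where "\<G> \<subseteq> \<T>" and "\<F> = soft_trace E Y ` \<G>"
      using family by (auto simp: subset_image_iff)
    then show ?thesis
      using assms(1) unfolding soft_topology_def
      by (auto simp: soft_trace_Union[symmetric])
  qed
qed

lemma soft_N_topological_space_subspace:
  assumes "soft_N_topological_space X \<T> N E" and "Y \<subseteq> X"
  shows "soft_N_topological_space Y (soft_N_subspace E Y \<T>) N E"
  using assms soft_topology_relative
  unfolding soft_N_topological_space_def soft_N_subspace_def by blast

lemma soft_N_open_trace:
  "soft_N_open \<T> N A \<Longrightarrow> soft_N_open (soft_N_subspace E Y \<T>) N (soft_trace E Y A)"
  by (auto simp: soft_N_open_def soft_N_subspace_def soft_relative_topology_eq_image)

lemma soft_belongs_soft_trace:
  assumes "x \<in> Y" and "\<alpha> \<in> E"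
  shows "soft_belongs E (soft_point E x \<alpha>) (soft_trace E Y A) \<longleftrightarrow>
         soft_belongs E (soft_point E x \<alpha>) A"
  using assms by (simp add: soft_belongs_soft_point soft_trace_def)

lemma N_wise_soft_T1_subspace:
  assumes T1: "N_wise_soft_T1 X \<T> N E" and "Y \<subseteq> X"
  shows "N_wise_soft_T1 Y (soft_N_subspace E Y \<T>) N E"
  unfolding N_wise_soft_T1_def
proof (intro conjI ballI impI)
  show "soft_N_topological_space Y (soft_N_subspace E Y \<T>) N E"
    using assms soft_N_topological_space_subspace unfolding N_wise_soft_T1_def by blast
next
  fix x \<alpha> y \<beta>
  assume pts: "x \<in> Y" "\<alpha> \<in> E" "y \<in> Y" "\<beta> \<in> E" and "x \<noteq> y \<or> \<alpha> \<noteq> \<beta>"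
  then obtain A where "soft_N_open \<T> N A"
    and "soft_belongs E (soft_point E x \<alpha>) A" "\<not> soft_belongs E (soft_point E y \<beta>) A"
    using T1 \<open>Y \<subseteq> X\<close> unfolding N_wise_soft_T1_def by (meson subsetD)
  then show "\<exists>A. soft_N_open (soft_N_subspace E Y \<T>) N A \<and>
      soft_belongs E (soft_point E x \<alpha>) A \<and> \<not> soft_belongs E (soft_point E y \<beta>) A"
    using pts by (intro exI[of _ "soft_trace E Y A"])
      (simp add: soft_N_open_trace soft_belongs_soft_trace)
qed

lemma N_wise_soft_T2_subspace:
  assumes T2: "N_wise_soft_T2 X \<T> N E" and "Y \<subseteq> X"
  shows "N_wise_soft_T2 Y (soft_N_subspace E Y \<T>) N E"
  unfolding N_wise_soft_T2_def
proof (intro conjI ballI impI)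
  show "soft_N_topological_space Y (soft_N_subspace E Y \<T>) N E"
    using assms soft_N_topological_space_subspace unfolding N_wise_soft_T2_def by blast
next
  fix x \<alpha> y \<beta>
  assume pts: "x \<in> Y" "\<alpha> \<in> E" "y \<in> Y" "\<beta> \<in> E" and "x \<noteq> y \<or> \<alpha> \<noteq> \<beta>"
  then obtain A B where "soft_N_open \<T> N A" "soft_N_open \<T> N B"
    and "soft_belongs E (soft_point E x \<alpha>) A" "soft_belongs E (soft_point E y \<beta>) B"
    and "soft_inter E A B = null_soft_set E"
    using T2 \<open>Y \<subseteq> X\<close> unfolding N_wise_soft_T2_def by (meson subsetD)
  then show "\<exists>A B. soft_N_open (soft_N_subspace E Y \<T>) N A \<and>
      soft_N_open (soft_N_subspace E Y \<T>) N B \<and>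
      soft_belongs E (soft_point E x \<alpha>) A \<and> soft_belongs E (soft_point E y \<beta>) B \<and>
      soft_inter E A B = null_soft_set E"
    using pts by (intro exI[of _ "soft_trace E Y A"] exI[of _ "soft_trace E Y B"])
      (simp add: soft_N_open_trace soft_belongs_soft_trace soft_trace_inter[symmetric]
        soft_trace_null)
qed

theorem proposition4p10:
  fixes X Y :: "'a set" and E :: "'e set" and N :: nat
    and \<T> :: "nat \<Rightarrow> ('e, 'a) soft_set set"
  assumes "E \<noteq> {}" and "N \<ge> 1" and "Y \<noteq> {}" and "Y \<subseteq> X"
  shows "(N_wise_soft_T1 X \<T> N E \<longrightarrow> N_wise_soft_T1 Y (soft_N_subspace E Y \<T>) N E) \<and>
         (N_wise_soft_T2 X \<T> N E \<longrightarrow> N_wise_soft_T2 Y (soft_N_subspace E Y \<T>) N E)"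
  using \<open>Y \<subseteq> X\<close> N_wise_soft_T1_subspace N_wise_soft_T2_subspace by blast

end
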